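(* There exist a constant $c>0$ and an infinite sequence $M_1,M_2,\ldots$ of partial $0$-$1$ matrices with $\operatorname{rank}_+(M_t)\to\infty$ as $t\to\infty$ such that for every $t$, $$\operatorname{rank}_{0,1}(M_t)\ \ge\ 2^{\operatorname{rank}_+(M_t)^{c}}.$$
   Context: A partial $0$-$1$ matrix is a finite matrix with entries in $\{0,1,*\}$, where $*$ entries are wildcards. For a total $n\times m$ real matrix $N$ with nonnegative entries, the nonnegative rank $\operatorname{rank}_+(N)$ is the smallest $r$ such that $N=UV$ with $U$ an $n\times r$ and $V$ an $r\times m$ real matrix, both entrywise nonnegative. For a total $n\times m$ matrix $N$ with nonnegative integer entries, the binary rank $\operatorname{rank}_{0,1}(N)$ is the smallest $r$ such that $N=UV$ (ordinary arithmetic over the reals) with $U$ an $n\times r$ and $V$ an $r\times m$ matrix, both with all entries in $\{0,1\}$. For a partial $0$-$1$ matrix $M$, $\operatorname{rank}_+(M)$ is the minimum of $\operatorname{rank}_+(N)$ over all total real matrices $N$ with nonnegative entries that agree with $M$ on all non-$*$ entries of $M$; and $\operatorname{rank}_{0,1}(M)$ is the minimum of $\operatorname{rank}_{0,1}(N)$ over all total matrices $N$ with nonnegative integer entries that agree with $M$ on all non-$*$ entries of $M$. In both cases the entries of $N$ at the $*$ positions need not lie in $\{0,1\}$. *)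

theory Defs
  imports Complex_Main "Jordan_Normal_Form.Matrix"
begin

(* None is the wildcard entry; Some False and Some True are the entries 0 and 1. *)
type_synonym partial_mat = "bool option mat"

definition entries_in :: "'a set \<Rightarrow> 'a mat \<Rightarrow> bool" where
  "entries_in S A \<longleftrightarrow> (\<forall>i < dim_row A. \<forall>j < dim_col A. A $$ (i, j) \<in> S)"

definition agrees_with :: "real mat \<Rightarrow> partial_mat \<Rightarrow> bool" where
  "agrees_with N M \<longleftrightarrow>
     N \<in> carrier_mat (dim_row M) (dim_col M) \<and>
     (\<forall>i < dim_row M. \<forall>j < dim_col M. \<forall>b. M $$ (i, j) = Some b \<longrightarrow> N $$ (i, j) = of_bool b)"

(* Factorizations with inner dimension r and all factor entries in S. *)
definition factors_over :: "real set \<Rightarrow> real mat \<Rightarrow> nat \<Rightarrow> bool" where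
  "factors_over S N r \<longleftrightarrow>
     (\<exists>U \<in> carrier_mat (dim_row N) r. \<exists>V \<in> carrier_mat r (dim_col N).
        entries_in S U \<and> entries_in S V \<and> N = U * V)"

(* Only meaningful when all entries of N are nonnegative; then N = N * 1 is a factorization. *)
definition nonneg_rank :: "real mat \<Rightarrow> nat" where
  "nonneg_rank N = (LEAST r. factors_over {0..} N r)"

(* Only meaningful when all entries of N are nonnegative integers; then N is a sum of
   0-1 matrices with a single nonzero entry, which gives a factorization. *)
definition binary_rank :: "real mat \<Rightarrow> nat" where
  "binary_rank N = (LEAST r. factors_over {0, 1} N r)"

(* The minima below are over nonempty sets: replace every wildcard by 0. *)
definition partial_nonneg_rank :: "partial_mat \<Rightarrow> nat" where
  "partial_nonneg_rank M =
     (LEAST r. \<exists>N. agrees_with N M \<and> entries_in {0..} N \<and> nonneg_rank N = r)"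

definition partial_binary_rank :: "partial_mat \<Rightarrow> nat" where
  "partial_binary_rank M =
     (LEAST r. \<exists>N. agrees_with N M \<and> entries_in \<nat> N \<and> binary_rank N = r)"

end

theory Submission
  imports Defs "HOL-Library.Z2"
begin

text \<open>Let \<open>k = q = 2 ^ e\<close>. Index rows and columns by words of length \<open>2k - 1\<close> over \<open>q\<close> letters; the
  entry is 1 if the two words agree in exactly \<open>k\<close> positions, 0 if they agree nowhere, and a
  wildcard otherwise. The number of agreements divided by \<open>k\<close> is a completion of nonnegative
  rank at most \<open>(2k - 1) q\<close>, and a fooling set of size \<open>q - 1\<close> makes the nonnegative rank unbounded.

  For the binary rank, reduce a completion \<open>N\<close> modulo two. With \<open>a\<close> the number of agreements, let
  \<open>D\<close> be the sum of the binomial coefficients \<open>a choose j\<close> over \<open>j < k\<close>. Modulo two it is the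
  indicator of \<open>a = 0 \<or> a = k\<close>, so whatever \<open>N\<close> does at the wildcards, the indicator of \<open>a = 0\<close> is
  \<open>D (1 + N)\<close> entrywise. The left-hand side has full rank \<open>q ^ (2k - 1)\<close> over the two-element
  field, while \<open>D\<close> has rank at most \<open>2 ^ (2k - 1) q ^ (k - 1)\<close>: it counts sets of fewer than \<open>k\<close>
  positions on which the words agree. Since rank is submultiplicative for entrywise products,
  \<open>1 + rank N\<close> is at least \<open>2 (q / 4) ^ k\<close>.\<close>

subsection \<open>Factorizations and the rank minima\<close>

text \<open>Lets rank-one terms be indexed by any finite set, such as pairs of a position and a
  letter; a bijection onto \<open>T\<close> renumbers them.\<close>

lemma factors_over_sumI:
  assumes "finite T"
    and "\<And>i t. i < dim_row N \<Longrightarrow> t \<in> T \<Longrightarrow> a i t \<in> S"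
    and "\<And>t j. t \<in> T \<Longrightarrow> j < dim_col N \<Longrightarrow> b t j \<in> S"
    and "\<And>i j. i < dim_row N \<Longrightarrow> j < dim_col N \<Longrightarrow> N $$ (i, j) = (\<Sum>t\<in>T. a i t * b t j)"
  shows "factors_over S N (card T)"
proof -
  obtain h where h: "bij_betw h {0..<card T} T"
    using ex_bij_betw_nat_finite[OF assms(1)] by blast
  define U where "U = mat (dim_row N) (card T) (\<lambda>(i, l). a i (h l))"
  define V where "V = mat (card T) (dim_col N) (\<lambda>(l, j). b (h l) j)"
  have hT: "h l \<in> T" if "l < card T" for l
    using h that by (auto simp: bij_betw_def)
  have "N = U * V"
  proof (rule eq_matI)
    fix i j assume ij: "i < dim_row (U * V)" "j < dim_col (U * V)"
    then have "(U * V) $$ (i, j) = (\<Sum>l\<in>{0..<card T}. a i (h l) * b (h l) j)"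
      by (simp add: U_def V_def scalar_prod_def)
    also have "\<dots> = (\<Sum>t\<in>T. a i t * b t j)"
      by (rule sum.reindex_bij_betw[OF h])
    finally show "N $$ (i, j) = (U * V) $$ (i, j)"
      using ij assms(4) by (simp add: U_def V_def)
  qed (simp_all add: U_def V_def)
  moreover have "entries_in S U" "entries_in S V"
    using assms(2,3) hT by (auto simp: entries_in_def U_def V_def)
  moreover have "U \<in> carrier_mat (dim_row N) (card T)" "V \<in> carrier_mat (card T) (dim_col N)"
    by (simp_all add: U_def V_def)
  ultimately show ?thesis
    unfolding factors_over_def by blast
qed

lemma factors_overE:
  assumes "factors_over S N r"
  obtains u v where
    "\<And>i l. i < dim_row N \<Longrightarrow> l < r \<Longrightarrow> u i l \<in> S"
    "\<And>l j. l < r \<Longrightarrow> j < dim_col N \<Longrightarrow> v l j \<in> S"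
    "\<And>i j. i < dim_row N \<Longrightarrow> j < dim_col N \<Longrightarrow> N $$ (i, j) = (\<Sum>l<r. u i l * v l j)"
proof -
  obtain U V where UV: "U \<in> carrier_mat (dim_row N) r" "V \<in> carrier_mat r (dim_col N)"
      "entries_in S U" "entries_in S V" and N: "N = U * V"
    using assms unfolding factors_over_def by blast
  have prod: "(U * V) $$ (i, j) = (\<Sum>l<r. U $$ (i, l) * V $$ (l, j))"
    if "i < dim_row N" "j < dim_col N" for i j
    using that UV(1,2) by (auto simp: scalar_prod_def lessThan_atLeast0)
  show thesis
  proof (rule that[of "\<lambda>i l. U $$ (i, l)" "\<lambda>l j. V $$ (l, j)"])
    show "N $$ (i, j) = (\<Sum>l<r. U $$ (i, l) * V $$ (l, j))"
      if "i < dim_row N" "j < dim_col N" for i j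
      using prod[OF that] N by simp
  qed (use UV in \<open>auto simp: entries_in_def\<close>)
qed

lemma ex_nonneg_factors:
  assumes "entries_in {0..} N"
  shows "\<exists>r. factors_over {0..} N r"
proof -
  have "factors_over {0..} N (card {..<dim_col N})"
  proof (rule factors_over_sumI)
    show "N $$ (i, j) = (\<Sum>t<dim_col N. N $$ (i, t) * of_bool (t = j))"
      if "i < dim_row N" "j < dim_col N" for i j
      using that by (simp add: of_bool_def if_distrib cong: if_cong)
  qed (use assms in \<open>auto simp: entries_in_def\<close>)
  then show ?thesis by blast
qed

text \<open>Unary expansion: column \<open>j'\<close> of \<open>N\<close> is split into
  \<open>K\<close> layers of zeros and ones, layer \<open>l\<close> marking the rows with
  \<open>l < c i j'\<close>. The sum of all entries serves as a crude common bound
  \<open>K\<close>.\<close>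

lemma ex_binary_factors:
  assumes "entries_in \<nat> N"
  shows "\<exists>r. factors_over {0, 1} N r"
proof -
  define c where "c i j = nat \<lfloor>N $$ (i, j)\<rfloor>" for i j
  have c: "real (c i j) = N $$ (i, j)" if "i < dim_row N" "j < dim_col N" for i j
  proof -
    have "N $$ (i, j) \<in> \<nat>"
      using assms that by (simp add: entries_in_def)
    then show ?thesis
      by (cases rule: Nats_cases) (simp add: c_def)
  qed
  define K where "K = (\<Sum>i<dim_row N. \<Sum>j<dim_col N. c i j)"
  have K: "c i j \<le> K" if "i < dim_row N" "j < dim_col N" for i j
  proof -
    have "c i j \<le> (\<Sum>j<dim_col N. c i j)"
      using that by (intro member_le_sum) auto
    also have "\<dots> \<le> K"
      unfolding K_def using that by (intro member_le_sum[of i]) auto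
    finally show ?thesis .
  qed
  have "factors_over {0, 1} N (card ({..<dim_col N} \<times> {..<K}))"
  proof (rule factors_over_sumI)
    fix i j assume ij: "i < dim_row N" "j < dim_col N"
    have "{l. l < K \<and> l < c i j} = {..<c i j}"
      using K[OF ij] by auto
    then have K_sum: "(\<Sum>l<K. of_bool (l < c i j)) = real (c i j)"
      by (simp add: of_bool_def sum.If_cases Int_def conj_commute)
    have "N $$ (i, j) = (\<Sum>j'<dim_col N. of_bool (j' = j) * (\<Sum>l<K. of_bool (l < c i j')))"
    proof -
      have "(\<Sum>j'<dim_col N. of_bool (j' = j) * (\<Sum>l<K. of_bool (l < c i j')))
          = (\<Sum>j'<dim_col N. if j' = j then \<Sum>l<K. of_bool (l < c i j') else 0 :: real)"
        by (rule sum.cong) auto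
      then show ?thesis
        using K_sum c[OF ij] ij by simp
    qed
    also have "\<dots> = (\<Sum>(j', l)\<in>{..<dim_col N} \<times> {..<K}. of_bool (l < c i j') * of_bool (j' = j))"
      by (simp only: sum.cartesian_product[symmetric] sum_distrib_left mult.commute)
    finally show "N $$ (i, j) = (\<Sum>t\<in>{..<dim_col N} \<times> {..<K}.
        of_bool (snd t < c i (fst t)) * of_bool (fst t = j))"
      by (simp add: case_prod_unfold)
  qed auto
  then show ?thesis by blast
qed

lemma ex_completion:
  assumes "0 \<in> S" "1 \<in> S"
  shows "\<exists>N. agrees_with N M \<and> entries_in S N"
  by (rule exI[of _ "mat (dim_row M) (dim_col M) (\<lambda>ij. of_bool (M $$ ij = Some True))"])
     (use assms in \<open>auto simp: agrees_with_def entries_in_def\<close>)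

text \<open>\<open>LEAST\<close> is informative only once a witness exists, so attainment is shown
  for both nested minima, over completions and over inner dimensions.\<close>

lemma partial_nonneg_rankE:
  obtains N where "agrees_with N M" "entries_in {0..} N" "factors_over {0..} N (partial_nonneg_rank M)"
proof -
  have "\<exists>r N. agrees_with N M \<and> entries_in {0..} N \<and> nonneg_rank N = r"
    using ex_completion[of "{0..}" M] by auto
  from LeastI_ex[OF this] obtain N
    where N: "agrees_with N M" "entries_in {0..} N" "nonneg_rank N = partial_nonneg_rank M"
    unfolding partial_nonneg_rank_def by blast
  have "factors_over {0..} N (nonneg_rank N)"
    unfolding nonneg_rank_def using ex_nonneg_factors[OF N(2)] by (rule LeastI_ex)
  then show thesis using that N by simp
qed

lemma partial_binary_rankE:
  obtains N where "agrees_with N M" "factors_over {0, 1} N (partial_binary_rank M)"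
proof -
  have "\<exists>r N. agrees_with N M \<and> entries_in \<nat> N \<and> binary_rank N = r"
    using ex_completion[of "\<nat>" M] by auto
  from LeastI_ex[OF this] obtain N
    where N: "agrees_with N M" "entries_in \<nat> N" "binary_rank N = partial_binary_rank M"
    unfolding partial_binary_rank_def by blast
  have "factors_over {0, 1} N (binary_rank N)"
    unfolding binary_rank_def using ex_binary_factors[OF N(2)] by (rule LeastI_ex)
  then show thesis using that N by simp
qed

lemma partial_nonneg_rank_le:
  assumes "agrees_with N M" "entries_in {0..} N" "factors_over {0..} N r"
  shows "partial_nonneg_rank M \<le> r"
proof -
  have "partial_nonneg_rank M \<le> nonneg_rank N"
    unfolding partial_nonneg_rank_def using assms by (intro Least_le) blast
  also have "\<dots> \<le> r"
    unfolding nonneg_rank_def using assms by (intro Least_le)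
  finally show ?thesis .
qed

text \<open>Each entry 1 at \<open>(x s, y s)\<close> has a nonzero term \<open>h s\<close>. If
  distinct \<open>s\<close> and \<open>t\<close> shared it, then that term would also be nonzero at
  \<open>(x s, y t)\<close>; nonnegative terms cannot cancel, so the entry there could not be
  0.\<close>

lemma fooling_set_le_nonneg_rank:
  assumes "\<And>s. s < m \<Longrightarrow> x s < dim_row M \<and> y s < dim_col M"
    and "\<And>s t. s < m \<Longrightarrow> t < m \<Longrightarrow> M $$ (x s, y t) = Some (s = t)"
  shows "m \<le> partial_nonneg_rank M"
proof -
  obtain N where N: "agrees_with N M" and f: "factors_over {0..} N (partial_nonneg_rank M)"
    using partial_nonneg_rankE by blast
  define r where "r = partial_nonneg_rank M"
  have dims: "dim_row N = dim_row M" "dim_col N = dim_col M"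
    using N by (auto simp: agrees_with_def)
  obtain u v where u: "\<And>i l. i < dim_row N \<Longrightarrow> l < r \<Longrightarrow> u i l \<in> {0..}"
    and v: "\<And>l j. l < r \<Longrightarrow> j < dim_col N \<Longrightarrow> v l j \<in> {0..}"
    and uv: "\<And>i j. i < dim_row N \<Longrightarrow> j < dim_col N \<Longrightarrow> N $$ (i, j) = (\<Sum>l<r. u i l * v l j)"
    using factors_overE[OF f[folded r_def]] by blast
  have Nst: "(\<Sum>l<r. u (x s) l * v l (y t)) = of_bool (s = t)" if "s < m" "t < m" for s t
    using N assms(1)[OF that(1)] assms(1)[OF that(2)] assms(2)[OF that] uv[of "x s" "y t"] dims
    by (auto simp: agrees_with_def)
  have "\<exists>l<r. u (x s) l * v l (y s) \<noteq> 0" if "s < m" for s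
    using Nst[OF that that] by (metis (mono_tags, lifting) lessThan_iff of_bool_eq(2) sum.neutral zero_neq_one)
  then obtain h where h: "\<And>s. s < m \<Longrightarrow> h s < r \<and> u (x s) (h s) * v (h s) (y s) \<noteq> 0"
    by metis
  have "inj_on h {..<m}"
  proof (rule inj_onI)
    fix s t assume st: "s \<in> {..<m}" "t \<in> {..<m}" "h s = h t"
    show "s = t"
    proof (rule ccontr)
      assume "s \<noteq> t"
      then have "(\<Sum>l<r. u (x s) l * v l (y t)) = 0"
        using Nst[of s t] st by simp
      moreover have "u (x s) l * v l (y t) \<ge> 0" if "l < r" for l
        using u[of "x s" l] v[of l "y t"] that st assms(1) dims by auto
      ultimately have "\<forall>l<r. u (x s) l * v l (y t) = 0"
        by (subst (asm) sum_nonneg_eq_0_iff) auto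
      then show False
        using h[of s] h[of t] st by auto
    qed
  qed
  moreover have "h ` {..<m} \<subseteq> {..<r}"
    using h by auto
  ultimately have "card {..<m} \<le> card {..<r}"
    by (meson card_inj_on_le finite_lessThan)
  then show ?thesis by (simp add: r_def)
qed

subsection \<open>Binomial coefficients modulo two\<close>

text \<open>A special case of Lucas' theorem, proved directly. For \<open>b = k - 1 + s\<close> with
  \<open>0 < s < k\<close>, absorption gives
  \<open>s * (b choose s) = k * (b choose (s - 1))\<close>; as \<open>k = 2 ^ e\<close> does not
  divide \<open>s\<close>, the factor \<open>b choose s\<close>, which equals
  \<open>b choose (k - 1)\<close>, is even.\<close>

lemma odd_choose_two_power_iff:
  fixes e b :: nat
  assumes "b + 1 < 2 * 2 ^ e"
  shows "odd (b choose (2 ^ e - 1)) \<longleftrightarrow> b = 2 ^ e - 1"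
proof -
  define k :: nat where "k = 2 ^ e"
  have kpos: "k \<ge> 1" by (simp add: k_def)
  have "even (b choose (k - 1))" if "b \<noteq> k - 1"
  proof (cases "b < k - 1")
    case True
    then show ?thesis by (simp add: binomial_eq_0)
  next
    case False
    define s where "s = b - (k - 1)"
    have s: "0 < s" "s < k" "b = k - 1 + s"
      using False that assms kpos by (auto simp: s_def k_def)
    have "s * (b choose s) = k * (b choose (s - 1))"
    proof -
      obtain s' where s': "s = Suc s'" using s(1) by (cases s) auto
      \<comment> \<open>Here \<open>b - s'\<close> is exactly \<open>k\<close>.\<close>
      have "Suc s' * (b choose Suc s') = (b - s') * (b choose s')"
        using binomial_absorb_comp[of b s'] binomial_absorption[of s' "b"]
          binomial_absorption[of s' "b - 1"] s s' kpos
        by (cases b) auto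
      then show ?thesis using s s' kpos by simp
    qed
    then have "2 ^ e dvd s * (b choose s)"
      by (simp add: k_def)
    moreover have "\<not> 2 ^ e dvd s"
      using s by (auto simp: k_def dest: dvd_imp_le)
    ultimately have "even (b choose s)"
      by (metis coprime_dvd_mult_left_iff coprime_power_left_iff coprime_left_2_iff_odd)
    then show ?thesis
      using s binomial_symmetric[of s b] by simp
  qed
  then show ?thesis by (auto simp: k_def)
qed

lemma bit_add_self: "x + x = (0 :: bit)"
  by (cases x) auto

lemma bit_of_nat_eq: "(of_nat m :: bit) = of_bool (odd m)"
  by (induction m) auto

text \<open>The alternating partial sum of a binomial row, with signs vanishing modulo two: Pascal's
  rule makes it telescope.\<close>

lemma sum_choose_bit: "(\<Sum>j\<le>m. of_nat (Suc a choose j)) = (of_nat (a choose m) :: bit)"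
  by (induction m) (auto simp: bit_add_self add.assoc[symmetric])

text \<open>For \<open>a = 0\<close> only the term \<open>j = 0\<close> survives; for
  \<open>a = Suc b\<close> the sum telescopes to \<open>b choose (2 ^ e - 1)\<close>, which is odd
  only at \<open>b = 2 ^ e - 1\<close>.\<close>

lemma sum_choose_less_two_power_bit:
  assumes "a < 2 * 2 ^ e"
  shows "(\<Sum>j<2 ^ e. of_nat (a choose j)) = (of_bool (a = 0 \<or> a = 2 ^ e) :: bit)"
proof (cases a)
  case 0
  have "(\<Sum>j<2 ^ e. of_nat (0 choose j)) = (\<Sum>j<(2 :: nat) ^ e. if j = 0 then 1 else (0 :: bit))"
    by (rule sum.cong) (auto simp: binomial_eq_0)
  then show ?thesis using 0 by simp
next
  case (Suc b)
  have "{..<2 ^ e} = {..2 ^ e - 1 :: nat}"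
    by (simp add: lessThan_Suc_atMost[symmetric])
  then have "(\<Sum>j<2 ^ e. of_nat (a choose j)) = (of_nat (b choose (2 ^ e - 1)) :: bit)"
    by (simp only: Suc sum_choose_bit)
  also have "\<dots> = of_bool (b = 2 ^ e - 1)"
    using odd_choose_two_power_iff[of b e] assms Suc by (simp add: bit_of_nat_eq)
  also have "b = 2 ^ e - 1 \<longleftrightarrow> a = 0 \<or> a = 2 ^ e"
    using Suc by (metis Suc_pred' diff_Suc_1 nat.distinct(1) zero_less_numeral zero_less_power)
  finally show ?thesis .
qed

subsection \<open>Agreements of words\<close>

text \<open>Extensional functions make equality of words the same as equality on \<open>T\<close>.
  Besides the full position set, \<open>T\<close> also ranges over subsets, giving subwords.\<close>

definition words :: "nat \<Rightarrow> nat set \<Rightarrow> (nat \<Rightarrow> nat) set" where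
  "words q T = T \<rightarrow>\<^sub>E {..<q}"

definition agreement :: "nat set \<Rightarrow> (nat \<Rightarrow> nat) \<Rightarrow> (nat \<Rightarrow> nat) \<Rightarrow> nat set" where
  "agreement A x y = {i \<in> A. x i = y i}"

lemma finite_words: "finite T \<Longrightarrow> finite (words q T)"
  by (simp add: words_def finite_PiE)

lemma card_words: "finite T \<Longrightarrow> card (words q T) = q ^ card T"
  by (simp add: words_def card_PiE)

lemma of_bool_prod: "finite A \<Longrightarrow> (\<Prod>i\<in>A. of_bool (P i)) = (of_bool (\<forall>i\<in>A. P i) :: bit)"
  by (induction A rule: finite_induct) auto

lemma sum_of_bool_eq_card:
  assumes "finite A"
  shows "(\<Sum>a\<in>A. of_bool (P a)) = (of_nat (card {a \<in> A. P a}) :: 'b :: semiring_1)"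
proof -
  have "(\<Sum>a\<in>A. of_bool (P a)) = (\<Sum>a\<in>A. if P a then 1 else (0 :: 'b))"
    by (rule sum.cong) auto
  also have "\<dots> = (\<Sum>a\<in>{a \<in> A. P a}. 1)"
    by (rule sum.inter_filter[OF assms, symmetric])
  finally show ?thesis by simp
qed

text \<open>For even \<open>q\<close> the matrix \<open>J - I\<close> of size \<open>q\<close> is an involution modulo two, and the
  disagreement matrix is a tensor power of it.\<close>

lemma no_agreement_involution:
  assumes "finite A" "even q" "x \<in> words q A" "z \<in> words q A"
  shows "(\<Sum>y\<in>words q A. of_bool (agreement A x y = {}) * of_bool (agreement A y z = {}))
    = (of_bool (x = z) :: bit)"
proof -
  \<comment> \<open>The square of \<open>J - I\<close> has entries \<open>q - 1\<close> on the
    diagonal and \<open>q - 2\<close> off it; for even \<open>q\<close> these are 1 and 0 modulo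
    two.\<close>
  have single: "(\<Sum>b<q. of_bool (a \<noteq> b) * of_bool (b \<noteq> c)) = (of_bool (a = c) :: bit)"
    if "a < q" "c < q" for a c
  proof -
    have "(\<Sum>b<q. of_bool (a \<noteq> b) * of_bool (b \<noteq> c)) = (\<Sum>b<q. of_bool (a \<noteq> b \<and> b \<noteq> c) :: bit)"
      by (rule sum.cong) auto
    also have "\<dots> = of_nat (card {b \<in> {..<q}. a \<noteq> b \<and> b \<noteq> c})"
      by (rule sum_of_bool_eq_card) simp
    also have "{b \<in> {..<q}. a \<noteq> b \<and> b \<noteq> c} = {..<q} - {a, c}"
      by auto
    also have "card ({..<q} - {a, c}) = q - card {a, c}"
      using that by (subst card_Diff_subset) auto
    also have "(of_nat (q - card {a, c}) :: bit) = of_bool (a = c)"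
    proof (cases "a = c")
      case True
      then show ?thesis using assms(2) that by (simp add: bit_of_nat_eq)
    next
      case False
      then have "2 \<le> q" using that by linarith
      then show ?thesis using assms(2) False by (simp add: bit_of_nat_eq)
    qed
    finally show ?thesis .
  qed
  have "(\<Sum>y\<in>words q A. of_bool (agreement A x y = {}) * of_bool (agreement A y z = {}))
      = (\<Sum>y\<in>words q A. \<Prod>i\<in>A. of_bool (x i \<noteq> y i) * of_bool (y i \<noteq> z i) :: bit)"
    using assms(1) by (intro sum.cong refl) (auto simp: of_bool_prod prod.distrib agreement_def)
  \<comment> \<open>The letters of \<open>y\<close> are chosen independently, so the sum over words
    factors by position.\<close>
  also have "\<dots> = (\<Prod>i\<in>A. \<Sum>b<q. of_bool (x i \<noteq> b) * of_bool (b \<noteq> z i))"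
    unfolding words_def using assms(1)
    by (subst prod_sum_PiE[where f = "\<lambda>i b. of_bool (x i \<noteq> b) * of_bool (b \<noteq> z i)"]) simp_all
  also have "\<dots> = (\<Prod>i\<in>A. of_bool (x i = z i))"
  proof (rule prod.cong[OF refl])
    fix i assume "i \<in> A"
    then have "x i < q" "z i < q"
      using assms(3,4) by (auto simp: words_def)
    then show "(\<Sum>b<q. of_bool (x i \<noteq> b) * of_bool (b \<noteq> z i)) = (of_bool (x i = z i) :: bit)"
      by (rule single)
  qed
  also have "\<dots> = of_bool (\<forall>i\<in>A. x i = z i)"
    by (rule of_bool_prod[OF assms(1)])
  also have "(\<forall>i\<in>A. x i = z i) \<longleftrightarrow> x = z"
    using PiE_ext[OF assms(3,4)[unfolded words_def]] by blast
  finally show ?thesis .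
qed

text \<open>For each \<open>T\<close> only \<open>w = restrict x T\<close> can contribute, and it
  does so when \<open>x\<close> and \<open>y\<close> agree on \<open>T\<close>; the sum thus counts
  the small subsets of the agreement set. Every summand is a function of \<open>x\<close> times a
  function of \<open>y\<close>, which bounds the rank.\<close>

lemma sum_small_agreements:
  assumes "finite A" and xy: "x \<in> words q A" "y \<in> words q A"
  shows "(\<Sum>(T, w)\<in>(SIGMA T:{T. T \<subseteq> A \<and> card T < k}. words q T).
      of_bool (restrict x T = w) * of_bool (restrict y T = w))
    = (\<Sum>j<k. of_nat (card (agreement A x y) choose j) :: bit)"
proof -
  let ?Ts = "{T. T \<subseteq> A \<and> card T < k}"
  have finT: "finite T" if "T \<in> ?Ts" for T
    by (rule finite_subset[OF _ assms(1)]) (use that in simp)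
  have fin: "finite ?Ts"
    by (rule finite_subset[of _ "Pow A"]) (use assms(1) in auto)
  have "(\<Sum>(T, w)\<in>(SIGMA T:?Ts. words q T). of_bool (restrict x T = w) * of_bool (restrict y T = w))
      = (\<Sum>T\<in>?Ts. \<Sum>w\<in>words q T. of_bool (restrict x T = w) * of_bool (restrict y T = w) :: bit)"
    by (rule sum.Sigma[symmetric]) (use fin finT finite_words in blast)+
  also have "\<dots> = (\<Sum>T\<in>?Ts. of_bool (T \<subseteq> agreement A x y))"
  proof (rule sum.cong[OF refl])
    fix T assume T: "T \<in> ?Ts"
    have xT: "restrict x T \<in> words q T"
      using xy T by (auto simp: words_def)
    have "(\<Sum>w\<in>words q T. of_bool (restrict x T = w) * of_bool (restrict y T = w))
        = (\<Sum>w\<in>words q T. if restrict x T = w then of_bool (restrict y T = w) else (0 :: bit))"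
      by (rule sum.cong) auto
    also have "\<dots> = of_bool (restrict y T = restrict x T)"
      using xT finite_words[OF finT[OF T]] by simp
    also have "restrict y T = restrict x T \<longleftrightarrow> (\<forall>i\<in>T. x i = y i)"
      by (auto simp: fun_eq_iff restrict_def)
    also have "\<dots> \<longleftrightarrow> T \<subseteq> agreement A x y"
      using T by (auto simp: agreement_def)
    finally show "(\<Sum>w\<in>words q T. of_bool (restrict x T = w) * of_bool (restrict y T = w))
        = (of_bool (T \<subseteq> agreement A x y) :: bit)" .
  qed
  also have "\<dots> = of_nat (card {T \<in> ?Ts. T \<subseteq> agreement A x y})"
    using fin by (rule sum_of_bool_eq_card)
  also have "{T \<in> ?Ts. T \<subseteq> agreement A x y} = (\<Union>j<k. {T. T \<subseteq> agreement A x y \<and> card T = j})"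
    by (auto simp: agreement_def)
  also have "card \<dots> = (\<Sum>j<k. card {T. T \<subseteq> agreement A x y \<and> card T = j})"
    using assms by (subst card_UN_disjoint) (auto simp: agreement_def)
  also have "\<dots> = (\<Sum>j<k. card (agreement A x y) choose j)"
    using assms by (simp add: n_subsets agreement_def)
  finally show ?thesis by (simp only: of_nat_sum)
qed

lemma card_small_subwords_le:
  assumes "finite A" "q \<ge> 1"
  shows "card (SIGMA T:{T. T \<subseteq> A \<and> card T < k}. words q T) \<le> 2 ^ card A * q ^ (k - 1)"
proof -
  let ?Ts = "{T. T \<subseteq> A \<and> card T < k}"
  have fin: "finite ?Ts"
    by (rule finite_subset[of _ "Pow A"]) (use assms(1) in auto)
  have finT: "finite T" if "T \<in> ?Ts" for T
    by (rule finite_subset[OF _ assms(1)]) (use that in simp)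
  have "card (SIGMA T:?Ts. words q T) = (\<Sum>T\<in>?Ts. card (words q T))"
    by (rule card_SigmaI) (use fin finT finite_words in blast)+
  also have "\<dots> = (\<Sum>T\<in>?Ts. q ^ card T)"
    by (intro sum.cong refl card_words finT)
  also have "\<dots> \<le> (\<Sum>T\<in>?Ts. q ^ (k - 1))"
    using assms(2) by (intro sum_mono power_increasing) auto
  also have "\<dots> = card ?Ts * q ^ (k - 1)" by simp
  also have "card ?Ts \<le> card (Pow A)"
    using assms(1) by (intro card_mono) auto
  finally show ?thesis using assms(1) by (simp add: card_Pow)
qed

subsection \<open>The lower bound for the binary rank\<close>

text \<open>A rank bound over a finite ring, obtained by counting: an injective linear map cannot
  factor through a smaller space.\<close>

lemma involution_card_le:
  fixes E :: "'a \<Rightarrow> 'a \<Rightarrow> 'b :: comm_ring_1"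
  assumes "finite W" "finite S" "finite (UNIV :: 'b set)"
    and inv: "\<And>x z. x \<in> W \<Longrightarrow> z \<in> W \<Longrightarrow> (\<Sum>y\<in>W. E x y * E y z) = of_bool (x = z)"
    and fac: "\<And>x y. x \<in> W \<Longrightarrow> y \<in> W \<Longrightarrow> E x y = (\<Sum>s\<in>S. \<alpha> x s * \<beta> s y)"
  shows "card W \<le> card S"
proof -
  \<comment> \<open>The compressed image of \<open>v\<close>, made extensional on \<open>S\<close>
    so that it lies in a finite set of known size.\<close>
  define F where "F v = (\<lambda>s\<in>S. \<Sum>z\<in>W. \<beta> s z * v z)" for v :: "'a \<Rightarrow> 'b"
  \<comment> \<open>Applying \<open>E\<close> twice returns \<open>v\<close> on \<open>W\<close>,
    and the first application depends on \<open>v\<close> only through \<open>F v\<close>.\<close>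
  have recover: "v x = (\<Sum>y\<in>W. E x y * (\<Sum>s\<in>S. \<alpha> y s * F v s))" if "x \<in> W" for x v
  proof -
    have "(\<Sum>y\<in>W. E x y * (\<Sum>s\<in>S. \<alpha> y s * F v s)) = (\<Sum>y\<in>W. E x y * (\<Sum>z\<in>W. E y z * v z))"
    proof (rule sum.cong[OF refl])
      fix y assume y: "y \<in> W"
      have "(\<Sum>s\<in>S. \<alpha> y s * F v s) = (\<Sum>s\<in>S. \<Sum>z\<in>W. \<alpha> y s * \<beta> s z * v z)"
        by (intro sum.cong refl) (simp only: F_def restrict_apply' sum_distrib_left mult.assoc)
      also have "\<dots> = (\<Sum>z\<in>W. \<Sum>s\<in>S. \<alpha> y s * \<beta> s z * v z)"
        by (rule sum.swap)
      also have "\<dots> = (\<Sum>z\<in>W. E y z * v z)"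
        using fac[OF y] by (simp add: sum_distrib_right)
      finally show "E x y * (\<Sum>s\<in>S. \<alpha> y s * F v s) = E x y * (\<Sum>z\<in>W. E y z * v z)"
        by simp
    qed
    also have "\<dots> = (\<Sum>y\<in>W. \<Sum>z\<in>W. E x y * E y z * v z)"
      by (simp add: sum_distrib_left mult.assoc)
    also have "\<dots> = (\<Sum>z\<in>W. \<Sum>y\<in>W. E x y * E y z * v z)"
      by (rule sum.swap)
    also have "\<dots> = (\<Sum>z\<in>W. of_bool (x = z) * v z)"
      using inv[OF that] by (intro sum.cong refl) (simp add: sum_distrib_right[symmetric])
    also have "\<dots> = (\<Sum>z\<in>W. if x = z then v z else 0)"
      by (rule sum.cong) auto
    also have "\<dots> = v x"
      using that assms(1) by simp
    finally show ?thesis by simp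
  qed
  have "inj_on F (W \<rightarrow>\<^sub>E UNIV)"
  proof (rule inj_onI)
    fix v v' assume v: "v \<in> W \<rightarrow>\<^sub>E UNIV" "v' \<in> W \<rightarrow>\<^sub>E UNIV" "F v = F v'"
    have "v x = v' x" if "x \<in> W" for x
      using recover[OF that, of v] recover[OF that, of v'] by (simp only: v(3))
    then show "v = v'"
      by (rule PiE_ext[OF v(1,2)])
  qed
  moreover have "F ` (W \<rightarrow>\<^sub>E UNIV) \<subseteq> S \<rightarrow>\<^sub>E UNIV"
    by (auto simp: F_def)
  moreover have "finite (S \<rightarrow>\<^sub>E (UNIV :: 'b set))"
    using assms(2,3) by (simp add: finite_PiE)
  ultimately have "card (W \<rightarrow>\<^sub>E (UNIV :: 'b set)) \<le> card (S \<rightarrow>\<^sub>E (UNIV :: 'b set))"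
    by (meson card_inj_on_le)
  then have pow: "card (UNIV :: 'b set) ^ card W \<le> card (UNIV :: 'b set) ^ card S"
    by (simp only: card_PiE[OF assms(1)] card_PiE[OF assms(2)] prod_constant)
  \<comment> \<open>Since 0 and 1 differ in the ring, the base of the powers exceeds 1 and the
    exponents can be compared.\<close>
  have "card {0, 1 :: 'b} \<le> card (UNIV :: 'b set)"
    by (rule card_mono[OF assms(3) subset_UNIV])
  then have "1 < card (UNIV :: 'b set)"
    by simp
  then show ?thesis
    using pow by (rule power_le_imp_le_exp)
qed

text \<open>With \<open>a\<close> agreements and \<open>c\<close> indices \<open>l\<close> covering
  the pair, \<open>of_bool (a = 0)\<close> equals
  \<open>of_bool (a = 0 \<or> a = 2 ^ e) * (c + 1)\<close> modulo two: \<open>a = 0\<close> forces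
  \<open>c = 0\<close>, \<open>a = 2 ^ e\<close> forces \<open>c = 1\<close> and hence
  \<open>1 + 1 = 0\<close>, and elsewhere the first factor kills an arbitrary
  \<open>c\<close>.\<close>

lemma unambiguous_cover_bound:
  fixes u :: "(nat \<Rightarrow> nat) \<Rightarrow> nat \<Rightarrow> bool" and v :: "nat \<Rightarrow> (nat \<Rightarrow> nat) \<Rightarrow> bool"
  assumes "finite A" "card A < 2 * 2 ^ e" "even q" "q > 0"
    and zero: "\<And>x y. x \<in> words q A \<Longrightarrow> y \<in> words q A \<Longrightarrow> card (agreement A x y) = 0
      \<Longrightarrow> card {l \<in> {..<r}. u x l \<and> v l y} = 0"
    and one: "\<And>x y. x \<in> words q A \<Longrightarrow> y \<in> words q A \<Longrightarrow> card (agreement A x y) = 2 ^ e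
      \<Longrightarrow> card {l \<in> {..<r}. u x l \<and> v l y} = 1"
  shows "q ^ card A \<le> (2 ^ card A * q ^ (2 ^ e - 1)) * (r + 1)"
proof -
  define P where "P = (SIGMA T:{T. T \<subseteq> A \<and> card T < 2 ^ e}. words q T)"
  have finP: "finite P"
    unfolding P_def using assms(1)
    by (intro finite_SigmaI finite_words finite_subset[of "{T. _ T}" "Pow A"])
      (auto intro: finite_subset[OF _ assms(1)])
  have "b \<in> {0, 1}" for b :: bit
    by (cases b) auto
  then have "finite (UNIV :: bit set)"
    by (intro finite_subset[of UNIV "{0, 1 :: bit}"]) auto
  have "card (words q A) \<le> card (P \<times> {..r})"
  proof (rule involution_card_le)
    show "(\<Sum>y\<in>words q A. of_bool (agreement A x y = {}) * of_bool (agreement A y z = {}))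
        = (of_bool (x = z) :: bit)" if "x \<in> words q A" "z \<in> words q A" for x z
      using no_agreement_involution assms that by blast
  next
    fix x y assume xy: "x \<in> words q A" "y \<in> words q A"
    let ?a = "card (agreement A x y)"
    let ?c = "card {l \<in> {..<r}. u x l \<and> v l y}"
    have fin: "finite (agreement A x y)" and "?a \<le> card A"
      using assms(1) by (auto simp: agreement_def intro: card_mono)
    then have a: "?a < 2 * 2 ^ e" using assms(2) by simp
    have D: "(\<Sum>(T, w)\<in>P. of_bool (restrict x T = w) * of_bool (restrict y T = w))
        = (of_bool (?a = 0 \<or> ?a = 2 ^ e) :: bit)"
      unfolding P_def using sum_small_agreements[OF assms(1) xy, of "2 ^ e"] sum_choose_less_two_power_bit[OF a]
      by simp
    \<comment> \<open>The extra index \<open>l = r\<close> carries the all-ones term that supplies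
      the summand 1.\<close>
    have "(\<Sum>l\<le>r. of_bool (l = r \<or> u x l) * of_bool (l = r \<or> v l y))
        = (\<Sum>l<r. of_bool (l = r \<or> u x l) * of_bool (l = r \<or> v l y)) + (1 :: bit)"
      by (simp add: lessThan_Suc_atMost[symmetric])
    also have "\<dots> = (\<Sum>l<r. of_bool (u x l \<and> v l y)) + 1"
      by (intro arg_cong2[of _ _ _ _ "(+)"] sum.cong) auto
    also have "\<dots> = of_nat ?c + 1"
      by (simp only: sum_of_bool_eq_card[OF finite_lessThan])
    finally have C: "(\<Sum>l\<le>r. of_bool (l = r \<or> u x l) * of_bool (l = r \<or> v l y)) = (of_nat ?c + 1 :: bit)" .
    have split: "(of_bool (a = 0) :: bit) = of_bool (a = 0 \<or> a = 2 ^ e) * (of_nat c + 1)"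
      if "a = 0 \<Longrightarrow> c = 0" "a = 2 ^ e \<Longrightarrow> c = 1" for a c :: nat
      using that by (cases "a = 0"; cases "a = 2 ^ e") (auto simp: bit_add_self)
    have "(of_bool (agreement A x y = {}) :: bit) = of_bool (?a = 0)"
      using fin by simp
    also have "\<dots> = of_bool (?a = 0 \<or> ?a = 2 ^ e) * (of_nat ?c + 1)"
      by (rule split[OF zero[OF xy] one[OF xy]])
    also have "\<dots> = (\<Sum>p\<in>P. of_bool (restrict x (fst p) = snd p) * of_bool (restrict y (fst p) = snd p))
        * (\<Sum>l\<le>r. of_bool (l = r \<or> u x l) * of_bool (l = r \<or> v l y))"
      by (simp only: D[symmetric] C[symmetric] case_prod_unfold)
    \<comment> \<open>An entrywise product of rank-one terms is again rank one, so pairs of indices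
      give a factorization of the product.\<close>
    also have "\<dots> = (\<Sum>s\<in>P \<times> {..r}.
        (of_bool (restrict x (fst (fst s)) = snd (fst s)) * of_bool (snd s = r \<or> u x (snd s)))
        * (of_bool (restrict y (fst (fst s)) = snd (fst s)) * of_bool (snd s = r \<or> v (snd s) y)))"
      unfolding sum_product sum.cartesian_product
      by (rule sum.cong) (auto simp: mult_ac split: prod.splits)
    finally show "(of_bool (agreement A x y = {}) :: bit) = (\<Sum>s\<in>P \<times> {..r}.
        (of_bool (restrict x (fst (fst s)) = snd (fst s)) * of_bool (snd s = r \<or> u x (snd s)))
        * (of_bool (restrict y (fst (fst s)) = snd (fst s)) * of_bool (snd s = r \<or> v (snd s) y)))" .
  qed (use assms(1) finP finite_words \<open>finite (UNIV :: bit set)\<close> in auto)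
  also have "\<dots> = card P * (r + 1)"
    by (simp only: card_cartesian_product card_atMost Suc_eq_plus1)
  also have "\<dots> \<le> (2 ^ card A * q ^ (2 ^ e - 1)) * (r + 1)"
  proof (rule mult_right_mono)
    show "card P \<le> 2 ^ card A * q ^ (2 ^ e - 1)"
      unfolding P_def using assms by (intro card_small_subwords_le) auto
  qed simp
  finally show ?thesis
    unfolding card_words[OF assms(1)] .
qed

subsection \<open>The agreement matrices\<close>

text \<open>Matrix indices are numbers, so \<open>f\<close> enumerates the words.\<close>

definition agreement_mat :: "nat set \<Rightarrow> nat \<Rightarrow> nat \<Rightarrow> (nat \<Rightarrow> nat \<Rightarrow> nat) \<Rightarrow> partial_mat" where
  "agreement_mat A k m f = mat m m (\<lambda>(i, j).
     let a = card (agreement A (f i) (f j)) in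
     if a = 0 then Some False else if a = k then Some True else None)"

lemma agreement_mat_index:
  assumes "i < m" "j < m"
  shows "agreement_mat A k m f $$ (i, j) = (let a = card (agreement A (f i) (f j)) in
     if a = 0 then Some False else if a = k then Some True else None)"
  using assms by (simp add: agreement_mat_def)

lemma dim_agreement_mat [simp]:
  "dim_row (agreement_mat A k m f) = m" "dim_col (agreement_mat A k m f) = m"
  by (simp_all add: agreement_mat_def)

text \<open>Agreements are counted by summing, over positions \<open>c\<close> and letters
  \<open>s\<close>, the rank-one indicator that both words have \<open>s\<close> at
  \<open>c\<close>. Dividing by \<open>k\<close> turns \<open>k\<close> agreements into the entry
  1.\<close>

lemma agreement_mat_nonneg_rank_le:
  assumes "finite A" "k > 0" "\<And>i. i < m \<Longrightarrow> f i \<in> words q A"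
  shows "partial_nonneg_rank (agreement_mat A k m f) \<le> card A * q"
proof -
  define N where "N = mat m m (\<lambda>(i, j). real (card (agreement A (f i) (f j))) / real k)"
  have "factors_over {0..} N (card (A \<times> {..<q}))"
  proof (rule factors_over_sumI)
    fix i j assume ij: "i < dim_row N" "j < dim_col N"
    then have im: "i < m" "j < m" by (simp_all add: N_def)
    have "(\<Sum>t\<in>A \<times> {..<q}. (of_bool (f i (fst t) = snd t) / real k) * of_bool (f j (fst t) = snd t))
        = (\<Sum>c\<in>A. \<Sum>s<q. (of_bool (f i c = s) / real k) * of_bool (f j c = s))"
      by (simp add: sum.cartesian_product case_prod_unfold)
    also have "\<dots> = (\<Sum>c\<in>A. of_bool (f i c = f j c) / real k)"
    proof (rule sum.cong[OF refl])
      fix c assume c: "c \<in> A"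
      have "f i c < q"
        using PiE_mem[OF assms(3)[OF im(1), unfolded words_def] c] by simp
      have "(\<Sum>s<q. (of_bool (f i c = s) / real k) * of_bool (f j c = s))
          = (\<Sum>s<q. if f i c = s then of_bool (f j c = s) / real k else 0)"
        by (rule sum.cong) auto
      also have "\<dots> = of_bool (f i c = f j c) / real k"
        using \<open>f i c < q\<close> by auto
      finally show "(\<Sum>s<q. (of_bool (f i c = s) / real k) * of_bool (f j c = s))
        = of_bool (f i c = f j c) / real k" .
    qed
    also have "\<dots> = real (card (agreement A (f i) (f j))) / real k"
      using assms(1) by (simp add: sum_divide_distrib[symmetric] of_bool_def sum.If_cases agreement_def Int_def)
    finally show "N $$ (i, j) = (\<Sum>t\<in>A \<times> {..<q}.
        (of_bool (f i (fst t) = snd t) / real k) * of_bool (f j (fst t) = snd t))"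
      using im by (simp add: N_def)
  qed (use assms(1) in auto)
  moreover have "agrees_with N (agreement_mat A k m f)"
    using assms(2) by (auto simp: agrees_with_def N_def agreement_mat_index Let_def split: if_splits)
  moreover have "entries_in {0..} N"
    by (auto simp: entries_in_def N_def)
  ultimately show ?thesis
    using partial_nonneg_rank_le assms(1) by (metis card_cartesian_product card_lessThan)
qed

lemma agreement_mat_nonneg_rank_ge:
  assumes "finite A" "k \<le> card A" "k > 0" "words q A \<subseteq> f ` {..<m}"
  shows "q - 1 \<le> partial_nonneg_rank (agreement_mat A k m f)"
proof -
  obtain B where B: "B \<subseteq> A" "card B = k"
    using assms(1,2) by (meson obtain_subset_with_card_n)
  define X where "X s = (\<lambda>i\<in>A. s)" for s :: nat
  \<comment> \<open>The letter \<open>q - 1\<close> is reserved as filler outside \<open>B\<close>,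
    so the constant word \<open>X s\<close> with \<open>s < q - 1\<close> meets \<open>Y t\<close>
    only inside \<open>B\<close>, and only if \<open>s = t\<close>. This costs one letter and gives
    the bound \<open>q - 1\<close>.\<close>
  define Y where "Y s = (\<lambda>i\<in>A. if i \<in> B then s else q - 1)" for s
  have "X s \<in> words q A" "Y s \<in> words q A" if "s < q - 1" for s
    using that by (auto simp: X_def Y_def words_def)
  then have "\<exists>i<m. f i = X s" "\<exists>i<m. f i = Y s" if "s < q - 1" for s
    using that assms(4) by (metis (no_types, lifting) imageE lessThan_iff subsetD)+
  then obtain x y where x: "\<And>s. s < q - 1 \<Longrightarrow> x s < m \<and> f (x s) = X s"
    and y: "\<And>s. s < q - 1 \<Longrightarrow> y s < m \<and> f (y s) = Y s"
    by metis
  have "agreement A (X s) (Y t) = (if s = t then B else {})" if "s < q - 1" for s t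
    using B(1) that by (auto simp: agreement_def X_def Y_def split: if_splits)
  then have "agreement_mat A k m f $$ (x s, y t) = Some (s = t)" if "s < q - 1" "t < q - 1" for s t
    using x[OF that(1)] y[OF that(2)] that assms(3) B(2) by (auto simp: agreement_mat_index)
  then show ?thesis
    using x y by (intro fooling_set_le_nonneg_rank[of _ x _ y]) auto
qed

lemma agreement_mat_binary_rank_ge:
  assumes "finite A" "card A < 2 * 2 ^ e" "even q" "q > 0" "bij_betw f {..<m} (words q A)"
  shows "q ^ card A \<le> (2 ^ card A * q ^ (2 ^ e - 1)) * (partial_binary_rank (agreement_mat A (2 ^ e) m f) + 1)"
proof -
  let ?M = "agreement_mat A (2 ^ e) m f"
  define r where "r = partial_binary_rank ?M"
  obtain N where N: "agrees_with N ?M" and fo: "factors_over {0, 1} N r"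
    unfolding r_def using partial_binary_rankE by blast
  have dims: "dim_row N = m" "dim_col N = m"
    using N by (auto simp: agrees_with_def)
  obtain u v where u: "\<And>i l. i < dim_row N \<Longrightarrow> l < r \<Longrightarrow> u i l \<in> {0, 1}"
    and v: "\<And>l j. l < r \<Longrightarrow> j < dim_col N \<Longrightarrow> v l j \<in> {0, 1}"
    and uv: "\<And>i j. i < dim_row N \<Longrightarrow> j < dim_col N \<Longrightarrow> N $$ (i, j) = (\<Sum>l<r. u i l * v l j)"
    using factors_overE[OF fo] by blast
  define g where "g = inv_into {..<m} f"
  have g: "g x < m" "f (g x) = x" if "x \<in> words q A" for x
    using that assms(5) unfolding g_def bij_betw_def
    by (metis inv_into_into lessThan_iff, metis f_inv_into_f)
  \<comment> \<open>With 0-1 factors an entry of the completion counts the indices at which both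
    factors are 1, so known entries fix this count and wildcards leave it free.\<close>
  have count: "real (card {l \<in> {..<r}. u (g x) l = 1 \<and> v l (g y) = 1}) = N $$ (g x, g y)"
    if xy: "x \<in> words q A" "y \<in> words q A" for x y
  proof -
    have "N $$ (g x, g y) = (\<Sum>l<r. if u (g x) l = 1 \<and> v l (g y) = 1 then 1 else 0)"
      unfolding uv[of "g x" "g y", unfolded dims, OF g(1)[OF xy(1)] g(1)[OF xy(2)]]
    proof (rule sum.cong[OF refl])
      fix l assume "l \<in> {..<r}"
      then have "u (g x) l \<in> {0, 1}" "v l (g y) \<in> {0, 1}"
        using u[of "g x" l] v[of l "g y"] g xy dims by auto
      then show "u (g x) l * v l (g y) = (if u (g x) l = 1 \<and> v l (g y) = 1 then 1 else 0)"
        by auto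
    qed
    then show ?thesis by (simp add: sum.If_cases Int_def)
  qed
  have entry: "N $$ (g x, g y) = of_bool b"
    if "x \<in> words q A" "y \<in> words q A" "?M $$ (g x, g y) = Some b" for x y b
    using N that g by (auto simp: agrees_with_def)
  have "q ^ card A \<le> (2 ^ card A * q ^ (2 ^ e - 1)) * (r + 1)"
  proof (rule unambiguous_cover_bound[where u = "\<lambda>x l. u (g x) l = 1" and v = "\<lambda>l y. v l (g y) = 1"])
    fix x y assume xy: "x \<in> words q A" "y \<in> words q A"
    show "card {l \<in> {..<r}. u (g x) l = 1 \<and> v l (g y) = 1} = 0" if "card (agreement A x y) = 0"
      using entry[OF xy, of False] count[OF xy] that g xy by (simp add: agreement_mat_index)
    show "card {l \<in> {..<r}. u (g x) l = 1 \<and> v l (g y) = 1} = 1" if "card (agreement A x y) = 2 ^ e"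
      using entry[OF xy, of True] count[OF xy] that g xy by (simp add: agreement_mat_index)
  qed (use assms in auto)
  then show ?thesis by (simp add: r_def)
qed

lemma ex_separating_mat:
  fixes k :: nat
  assumes "k = 2 ^ e" "e \<ge> 3"
  shows "\<exists>M. k - 1 \<le> partial_nonneg_rank M \<and> partial_nonneg_rank M \<le> 2 * k ^ 2
    \<and> 2 ^ k \<le> partial_binary_rank M"
proof -
  \<comment> \<open>The greatest length below \<open>2 * k\<close>, as the parity lemma
    requires.\<close>
  define A where "A = {..<2 * k - 1}"
  have k8: "k \<ge> 8"
    using power_increasing[of 3 e "2::nat"] assms by simp
  have A: "finite A" "card A = 2 * k - 1" by (simp_all add: A_def)
  obtain f where f: "bij_betw f {..<card (words k A)} (words k A)"
    using ex_bij_betw_nat_finite[OF finite_words[OF A(1)]] by (auto simp: lessThan_atLeast0)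
  let ?M = "agreement_mat A k (card (words k A)) f"
  define r where "r = partial_binary_rank ?M"
  have "partial_nonneg_rank ?M \<le> card A * k"
    using f k8 A by (intro agreement_mat_nonneg_rank_le) (auto simp: bij_betw_def)
  also have "\<dots> \<le> 2 * k ^ 2"
    by (simp add: A power2_eq_square)
  finally have upper: "partial_nonneg_rank ?M \<le> 2 * k ^ 2" .
  have lower: "k - 1 \<le> partial_nonneg_rank ?M"
    using f k8 A by (intro agreement_mat_nonneg_rank_ge) (auto simp: bij_betw_def)
  have "k ^ (2 * k - 1) \<le> (2 ^ (2 * k - 1) * k ^ (k - 1)) * (r + 1)"
    using agreement_mat_binary_rank_ge[OF A(1) _ _ _ f, of e] assms k8 A by (simp add: r_def)
  \<comment> \<open>Splitting off \<open>k ^ (k - 1)\<close> cancels the count of subwords. What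
    remains, \<open>k ^ k\<close>, is at least \<open>8 ^ k\<close> because
    \<open>e \<ge> 3\<close>, and this exceeds \<open>2 ^ (2 * k - 1)\<close> by the factor
    \<open>2 ^ (k + 1)\<close>.\<close>
  also have "k ^ (2 * k - 1) = k ^ k * k ^ (k - 1)"
    using k8 by (simp add: power_add[symmetric])
  finally have "k ^ (k - 1) * k ^ k \<le> k ^ (k - 1) * (2 ^ (2 * k - 1) * (r + 1))"
    by (simp only: mult_ac)
  moreover have "k ^ (k - 1) > 0"
    using k8 by simp
  ultimately have "k ^ k \<le> 2 ^ (2 * k - 1) * (r + 1)"
    by (metis nat_mult_le_cancel1)
  moreover have "(8::nat) ^ k \<le> k ^ k"
    using k8 by (simp add: power_mono)
  moreover have "(8::nat) ^ k = 2 ^ (2 * k - 1) * 2 ^ (k + 1)"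
  proof -
    have "(8::nat) ^ k = 2 ^ (3 * k)"
      by (simp add: power_mult)
    also have "3 * k = (2 * k - 1) + (k + 1)"
      using k8 by simp
    finally show ?thesis
      by (simp only: power_add)
  qed
  ultimately have "2 ^ (2 * k - 1) * 2 ^ (k + 1) \<le> 2 ^ (2 * k - 1) * (r + 1)"
    by linarith
  then have "2 ^ (k + 1) \<le> r + 1"
    by (rule mult_left_le_imp_le) simp
  then have "2 ^ k \<le> r"
    using one_le_power[of "2::nat" k] by simp
  then show ?thesis
    using upper lower by (auto simp: r_def)
qed

theorem theorem1:
  "\<exists>c > (0::real). \<exists>M :: nat \<Rightarrow> partial_mat.
     filterlim (\<lambda>t. partial_nonneg_rank (M t)) at_top sequentially \<and>
     (\<forall>t. real (partial_binary_rank (M t)) \<ge> 2 powr (real (partial_nonneg_rank (M t)) powr c))"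
proof -
  \<comment> \<open>The shift by 3 ensures \<open>e \<ge> 3\<close> for every
    \<open>t\<close>.\<close>
  have "\<exists>M. 2 ^ (t + 3) - 1 \<le> partial_nonneg_rank M \<and> partial_nonneg_rank M \<le> 2 * (2 ^ (t + 3)) ^ 2
      \<and> 2 ^ (2 ^ (t + 3)) \<le> partial_binary_rank M" for t :: nat
    by (rule ex_separating_mat) auto
  then obtain M where lower: "\<And>t. 2 ^ (t + 3) - 1 \<le> partial_nonneg_rank (M t)"
    and upper: "\<And>t. partial_nonneg_rank (M t) \<le> 2 * (2 ^ (t + 3)) ^ 2"
    and binary: "\<And>t. 2 ^ (2 ^ (t + 3)) \<le> partial_binary_rank (M t)"
    by metis
  have "t \<le> partial_nonneg_rank (M t)" for t
  proof -
    have "t < 2 ^ (t + 3)"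
      using less_exp[of "t + 3"] by linarith
    then show ?thesis using lower[of t] by linarith
  qed
  then have "filterlim (\<lambda>t. partial_nonneg_rank (M t)) at_top sequentially"
    by (intro filterlim_at_top_mono[OF filterlim_ident]) auto
  \<comment> \<open>The exponent \<open>1 / 3\<close> comes from bounding \<open>2 * k ^ 2\<close>
    by \<open>k ^ 3\<close>: the nonnegative rank is then at most \<open>k ^ 3\<close>, while the
    binary rank is at least \<open>2 ^ k\<close>.\<close>
  moreover have "2 powr (real (partial_nonneg_rank (M t)) powr (1 / 3)) \<le> real (partial_binary_rank (M t))" for t
  proof -
    define k :: nat where "k = 2 ^ (t + 3)"
    have k: "k \<ge> 2" using power_increasing[of 1 "t + 3" "2::nat"] by (simp add: k_def)
    have "partial_nonneg_rank (M t) \<le> 2 * k ^ 2"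
      unfolding k_def by (rule upper)
    also have "\<dots> \<le> k * k ^ 2"
      using k by (rule mult_right_mono) simp
    also have "\<dots> = k ^ 3"
      by (simp add: power2_eq_square power3_eq_cube)
    finally have "partial_nonneg_rank (M t) \<le> k ^ 3" .
    then have "real (partial_nonneg_rank (M t)) \<le> real k powr 3"
      using k by (simp flip: of_nat_power)
    then have "real (partial_nonneg_rank (M t)) powr (1 / 3) \<le> (real k powr 3) powr (1 / 3)"
      by (intro powr_mono2) auto
    also have "\<dots> = real k"
      using k by (simp add: powr_powr del: powr_numeral)
    finally have "2 powr (real (partial_nonneg_rank (M t)) powr (1 / 3)) \<le> 2 powr real k"
      by simp
    also have "\<dots> = real (2 ^ k)"
      by (simp add: powr_realpow)
    also have "\<dots> \<le> real (partial_binary_rank (M t))"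
      using binary[of t] by (simp only: k_def of_nat_le_iff)
    finally show ?thesis .
  qed
  ultimately show ?thesis
    by (intro exI[of _ "1 / 3"] conjI exI[of _ M]) auto
qed

end
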